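(* There exists a proper holomorphic map $f=(f_1,f_2)\colon U\to\mathbb{C}^2$ whose image $f(U)$ is contained in $(\mathbb{C}\setminus\{0\})^2=\mathbb{C}^2\setminus\{(z,w): zw=0\}$.
   Context: $U=\{\zeta\in\mathbb{C}:|\zeta|<1\}$ is the open unit disc. Proper means proper as a map into $\mathbb{C}^2$, i.e. $|f(\zeta)|\to\infty$ as $|\zeta|\to1$. *)

theory Defs
  imports "HOL-Analysis.Analysis"
begin

text \<open>
  For continuous maps out of the open unit disc, the library's \<^const>\<open>proper_map\<close> says
  that the norm of \<open>f \<zeta>\<close> tends to infinity as the modulus of \<open>\<zeta>\<close> tends to 1 from below.
\<close>

lemma proper_map_unit_disc_iff:
  fixes f :: "complex \<Rightarrow> 'b::euclidean_space"
  assumes cont: "continuous_on (ball 0 1) f"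
  shows "proper_map (top_of_set (ball 0 1)) euclidean f \<longleftrightarrow>
         filterlim (\<lambda>\<zeta>. norm (f \<zeta>)) at_top (filtercomap norm (at_left 1))"
proof -
  let ?U = "ball (0::complex) 1"
  have proper_iff: "proper_map (top_of_set ?U) euclidean f \<longleftrightarrow>
      (\<forall>K. compact K \<longrightarrow> compact {\<zeta> \<in> ?U. f \<zeta> \<in> K})"
  proof -
    have "k_space (euclidean :: 'b topology)"
      by (simp add: locally_compact_imp_k_space locally_compact_space_euclidean)
    moreover have "kc_space (euclidean :: 'b topology)"
      by (simp add: Hausdorff_imp_kc_space)
    moreover have "continuous_map (top_of_set ?U) euclidean f"
      using cont by simp
    ultimately show ?thesis
      by (simp add: proper_eq_compact_map compactin_subtopology Collect_mono_iff subset_iff)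
  qed
  have lim_iff: "filterlim (\<lambda>\<zeta>. norm (f \<zeta>)) at_top (filtercomap norm (at_left 1)) \<longleftrightarrow>
      (\<forall>B. \<exists>r<1. \<forall>\<zeta>\<in>?U. r < norm \<zeta> \<longrightarrow> B \<le> norm (f \<zeta>))" (is "?L \<longleftrightarrow> ?R")
  proof
    assume L: ?L
    show ?R
    proof
      fix B
      have "\<forall>\<^sub>F \<zeta> in filtercomap norm (at_left 1). B \<le> norm (f \<zeta>)"
        using L by (simp add: filterlim_at_top)
      then obtain Q where Q: "eventually Q (at_left (1::real))"
          and QB: "\<And>\<zeta>. Q (norm \<zeta>) \<Longrightarrow> B \<le> norm (f \<zeta>)"
        by (auto simp: eventually_filtercomap)
      obtain r where "r < 1" "\<And>y. r < y \<Longrightarrow> y < 1 \<Longrightarrow> Q y"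
        using Q eventually_at_left[of 0 "1::real" Q] by auto
      then show "\<exists>r<1. \<forall>\<zeta>\<in>?U. r < norm \<zeta> \<longrightarrow> B \<le> norm (f \<zeta>)"
        using QB by (intro exI[of _ r]) auto
    qed
  next
    assume R: ?R
    show ?L
      unfolding filterlim_at_top
    proof
      fix B
      obtain r where r: "r < 1" "\<And>\<zeta>. norm \<zeta> < 1 \<Longrightarrow> r < norm \<zeta> \<Longrightarrow> B \<le> norm (f \<zeta>)"
        using R by (metis dist_0_norm mem_ball)
      have "eventually (\<lambda>y. r < y \<and> y < 1) (at_left (1::real))"
        using r(1) eventually_at_left[of 0 "1::real"] by auto
      then show "\<forall>\<^sub>F \<zeta> in filtercomap norm (at_left 1). B \<le> norm (f \<zeta>)"
        unfolding eventually_filtercomap using r(2) by blast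
    qed
  qed
  show ?thesis
    unfolding proper_iff lim_iff
  proof
    assume P: "\<forall>K. compact K \<longrightarrow> compact {\<zeta> \<in> ?U. f \<zeta> \<in> K}"
    show "\<forall>B. \<exists>r<1. \<forall>\<zeta>\<in>?U. r < norm \<zeta> \<longrightarrow> B \<le> norm (f \<zeta>)"
    proof
      fix B
      let ?C = "{\<zeta> \<in> ?U. f \<zeta> \<in> cball 0 B}"
      have C: "compact ?C"
        using P compact_cball by blast
      show "\<exists>r<1. \<forall>\<zeta>\<in>?U. r < norm \<zeta> \<longrightarrow> B \<le> norm (f \<zeta>)"
      proof (cases "?C = {}")
        case True
        then show ?thesis by (intro exI[of _ 0]) fastforce
      next
        case False
        obtain m where m: "m \<in> ?C" "\<And>\<zeta>. \<zeta> \<in> ?C \<Longrightarrow> norm \<zeta> \<le> norm m"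
          using continuous_attains_sup[OF C False continuous_on_norm_id] by blast
        have "B \<le> norm (f \<zeta>)" if "\<zeta> \<in> ?U" "norm m < norm \<zeta>" for \<zeta>
          using m(2)[of \<zeta>] that by (cases "f \<zeta> \<in> cball 0 B") auto
        moreover have "norm m < 1" using m(1) by simp
        ultimately show ?thesis by blast
      qed
    qed
  next
    assume R: "\<forall>B. \<exists>r<1. \<forall>\<zeta>\<in>?U. r < norm \<zeta> \<longrightarrow> B \<le> norm (f \<zeta>)"
    show "\<forall>K. compact K \<longrightarrow> compact {\<zeta> \<in> ?U. f \<zeta> \<in> K}"
    proof (intro allI impI)
      fix K :: "'b set"
      assume K: "compact K"
      obtain b where b: "\<And>x. x \<in> K \<Longrightarrow> norm x \<le> b"
        using compact_imp_bounded[OF K] by (auto simp: bounded_iff)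
      obtain r where r: "r < 1" "\<And>\<zeta>. \<zeta> \<in> ?U \<Longrightarrow> r < norm \<zeta> \<Longrightarrow> b + 1 \<le> norm (f \<zeta>)"
        using R by blast
      have sub: "cball 0 r \<subseteq> ?U" using r(1) by auto
      have "norm \<zeta> \<le> r" if "\<zeta> \<in> ?U" "f \<zeta> \<in> K" for \<zeta>
        using r(2)[OF that(1)] b[OF that(2)] by linarith
      then have eq: "{\<zeta> \<in> ?U. f \<zeta> \<in> K} = cball 0 r \<inter> f -` K"
        using sub by auto
      have "closed (cball 0 r \<inter> f -` K)"
        using continuous_on_subset[OF cont sub] K
        by (intro continuous_closed_preimage) (auto simp: compact_imp_closed)
      then show "compact {\<zeta> \<in> ?U. f \<zeta> \<in> K}"
        unfolding eq by (simp add: compact_eq_bounded_closed bounded_Int)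
    qed
  qed
qed

end

theory Submission
  imports Defs "HOL-Complex_Analysis.Cauchy_Integral_Formula"
begin

text \<open>
  A map into \<open>(\<complex> - {0})\<^sup>2\<close> on the simply connected disc has the form \<open>(exp g, exp h)\<close>, and it is
  proper exactly when \<open>max (Re g) (Re h)\<close> tends to infinity at the unit circle. Neither real part can
  do this alone, since its mean over a circle about 0 is its value at 0; the two have to share the
  work, and each may sink as deep as it likes where the other one is large.

  The pair \<open>(g, h)\<close> is a limit of pairs in the disc algebra. A step starts from a pair whose maximum
  of real parts is at least \<open>K\<close> on the unit circle, and adds functions of the two variables \<open>z\<close> and
  \<open>w = z ^ n\<close>, where \<open>n\<close> is huge. They vanish at \<open>w = 0\<close>, so they are negligible on a given smaller
  disc. Near the circle \<open>g\<close> and \<open>h\<close> vary slowly in comparison with \<open>w\<close>, so the step becomes a problem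
  about two numbers \<open>a = Re (g z)\<close>, \<open>b = Re (h z)\<close> with \<open>max a b \<ge> K\<close>: find harmonic functions of \<open>w\<close>,
  vanishing at 0 and depending continuously on \<open>(a, b)\<close>, whose addition to \<open>a\<close> and \<open>b\<close> makes the
  maximum at least \<open>K + 2\<close> for \<open>|w| = 1\<close> and lets it drop by a bounded amount for \<open>|w| \<le> 1\<close>.

  The solution (\<open>kern_push\<close>) uses \<open>1\<close> minus a Poisson kernel. It is positive on the circle away from
  the pole, so if \<open>a \<ge> K\<close> a fixed multiple of it raises \<open>a\<close> except near the pole, and there \<open>b\<close> is
  lifted, from however deep, by a large multiple of the same function with the opposite pole. Each
  multiple depends only on its own number, so the same formula serves where the roles of \<open>a\<close>
  and \<open>b\<close> change.

  The multiples are continuous functions of \<open>z\<close> rather than holomorphic ones, but on the circle they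
  are approximated by Laurent polynomials, and the factor \<open>z ^ n\<close> absorbs the negative powers
  (\<open>real_polynomial_function_on_circle\<close>, \<open>kern_wave\<close>). This gives the step \<open>raise_on_circle\<close>. Each step
  gains 1 on the circle, while the loss in the transitional annulus is at most 41 whatever \<open>K\<close> is, so
  in the limit the maximum tends to infinity (\<open>max_Re_unbounded_at_circle\<close>).
\<close>

section \<open>Two numbers and a pair of opposite Poisson kernels\<close>

text \<open>
  The real part is \<open>1 - (R\<^sup>2 - |w|\<^sup>2) / |R - w|\<^sup>2\<close> with \<open>R = 21/20\<close>, that is, \<open>1\<close> minus the Poisson kernel
  of the disc of radius \<open>R\<close> with pole at \<open>R\<close>. The radius exceeds 1 to keep the function regular on the
  closed unit disc, and it is so close to 1 that the Poisson kernel is at most \<open>1/2\<close> on the part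
  \<open>Re w \<le> 1/2\<close> of the unit circle.
\<close>

definition kern :: "complex \<Rightarrow> complex" where
  "kern w = - 2 * w / (21/20 - w)"

lemma kern_denominator:
  fixes w :: complex
  assumes "norm w \<le> 1"
  shows "1/20 \<le> norm (21/20 - w)"
proof -
  have "norm (21/20 :: complex) - norm w \<le> norm (21/20 - w)"
    by (rule norm_triangle_ineq2)
  then show ?thesis
    using assms by (simp add: norm_divide)
qed

lemma kern_denominator_sq_pos:
  assumes "norm w \<le> 1"
  shows "0 < (norm (21/20 - w :: complex))\<^sup>2"
proof -
  have "0 < norm (21/20 - w)"
    using kern_denominator[OF assms] by linarith
  then show ?thesis
    by (rule zero_less_power)
qed

text \<open>
  The condition on \<open>c\<close> is \<open>c * |R - w|\<^sup>2 \<le> Re (kern w) * |R - w|\<^sup>2\<close>, expanded so that it is linear in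
  \<open>Re w\<close> and \<open>|w|\<^sup>2\<close>.
\<close>

lemma Re_kern_ge:
  assumes w: "norm w \<le> 1"
    and c: "c * (441/400 - 21/10 * Re w + (norm w)\<^sup>2) \<le> 2 * ((norm w)\<^sup>2 - 21/20 * Re w)"
  shows "c \<le> Re (kern w)"
proof -
  have "kern w = - 2 * w * cnj (21/20 - w) / of_real ((norm (21/20 - w))\<^sup>2)"
    unfolding kern_def by (subst complex_div_cnj) simp
  then have "Re (kern w) = Re (- 2 * w * cnj (21/20 - w)) / (norm (21/20 - w))\<^sup>2"
    by (simp only: Re_divide_of_real)
  also have "Re (- 2 * w * cnj (21/20 - w)) = 2 * ((norm w)\<^sup>2 - 21/20 * Re w)"
    unfolding cmod_power2 by (simp add: power2_eq_square algebra_simps)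
  finally have Re: "Re (kern w) = 2 * ((norm w)\<^sup>2 - 21/20 * Re w) / (norm (21/20 - w))\<^sup>2" .
  have "(norm (21/20 - w))\<^sup>2 = 441/400 - 21/10 * Re w + (norm w)\<^sup>2"
    unfolding cmod_power2 by (simp add: power2_eq_square algebra_simps)
  then show ?thesis
    unfolding Re pos_le_divide_eq[OF kern_denominator_sq_pos[OF w]] using c by simp
qed

lemma Re_kern_bounded_below:
  assumes "norm w \<le> 1" "Re w \<le> 1/2"
  shows "- 4 \<le> Re (kern w)"
proof (rule Re_kern_ge[OF assms(1)])
  have "0 \<le> (Re w - 1/2)\<^sup>2 + (Im w)\<^sup>2"
    by simp
  also have "\<dots> = (norm w)\<^sup>2 - Re w + 1/4"
    unfolding cmod_power2 by (simp add: power2_eq_square algebra_simps)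
  finally show "- 4 * (441/400 - 21/10 * Re w + (norm w)\<^sup>2) \<le> 2 * ((norm w)\<^sup>2 - 21/20 * Re w)"
    using assms(2) by simp
qed

lemma Re_kern_opposite_pole:
  assumes "norm w \<le> 1" "Re w \<le> - 1/2"
  shows "1/5 \<le> Re (kern w)"
proof (rule Re_kern_ge[OF assms(1)])
  define q where "q = (norm w)\<^sup>2"
  have "0 \<le> q"
    by (simp add: q_def)
  then show "1/5 * (441/400 - 21/10 * Re w + (norm w)\<^sup>2) \<le> 2 * ((norm w)\<^sup>2 - 21/20 * Re w)"
    unfolding q_def[symmetric] using assms(2) by (simp add: field_simps)
qed

lemma Re_kern_circle:
  assumes "norm w = 1" "Re w \<le> 1/2"
  shows "1/2 \<le> Re (kern w)"
  using assms by (intro Re_kern_ge) simp_all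

text \<open>
  The factor 5 is the inverse of the bound in \<open>Re_kern_opposite_pole\<close>: on the half where that bound
  applies, this multiple of the kernel lifts \<open>a\<close> to \<open>K + 2\<close> or more. Where \<open>a \<ge> K\<close> the weight is the
  constant 10, which keeps the dips of the kernel within \<open>4 * 10\<close> of \<open>K\<close>.
\<close>

definition weight :: "real \<Rightarrow> real \<Rightarrow> real" where
  "weight K a = 5 * (2 + max 0 (K - a))"

text \<open>
  If \<open>Re w \<le> 1/2\<close>, the first entry is high enough, being lowered by at most 40, and raised by at
  least 5 on the circle. If \<open>Re w \<ge> 1/2\<close>, then \<open>- w\<close> is far from the pole and the second entry
  reaches \<open>K + 2\<close>.
\<close>

lemma kern_push_left:
  assumes w: "norm w \<le> 1" and a: "K \<le> a"
  shows "K - 40 \<le> max (a + weight K a * Re (kern w)) (b + weight K b * Re (kern (- w)))"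
    and "norm w = 1 \<Longrightarrow>
         K + 2 \<le> max (a + weight K a * Re (kern w)) (b + weight K b * Re (kern (- w)))"
proof -
  have s: "weight K a = 10"
    using a by (simp add: weight_def)
  have near: "K + 2 \<le> b + weight K b * Re (kern (- w))" if "1/2 \<le> Re w"
  proof -
    have "weight K b * (1/5) \<le> weight K b * Re (kern (- w))"
      using Re_kern_opposite_pole[of "- w"] w that
      by (intro mult_left_mono) (auto simp: weight_def)
    moreover have "K + 2 \<le> b + weight K b * (1/5)"
      by (simp add: weight_def max_def field_simps)
    ultimately show ?thesis
      by linarith
  qed
  show "K - 40 \<le> max (a + weight K a * Re (kern w)) (b + weight K b * Re (kern (- w)))"
    using near Re_kern_bounded_below[OF w] a unfolding s by linarith
  show "K + 2 \<le> max (a + weight K a * Re (kern w)) (b + weight K b * Re (kern (- w)))"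
    if "norm w = 1"
    using near Re_kern_circle[OF that] a unfolding s by linarith
qed

text \<open>
  The construction is invariant under exchanging \<open>a\<close> with \<open>b\<close> and \<open>w\<close> with \<open>- w\<close>, so one of the two cases
  suffices.
\<close>

lemma kern_push:
  assumes w: "norm w \<le> 1" and ab: "K \<le> max a b"
  shows "K - 40 \<le> max (a + weight K a * Re (kern w)) (b + weight K b * Re (kern (- w)))"
    and "norm w = 1 \<Longrightarrow>
         K + 2 \<le> max (a + weight K a * Re (kern w)) (b + weight K b * Re (kern (- w)))"
  using kern_push_left[OF w, of K a b] kern_push_left[of "- w" K b a] w ab
  by (cases "K \<le> a"; force simp: max.commute)+

section \<open>Raising the maximum by holomorphic perturbations\<close>

definition disc_algebra :: "(complex \<Rightarrow> complex) set" where
  "disc_algebra = {g. continuous_on (cball 0 1) g \<and> g holomorphic_on ball 0 1}"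

text \<open>
  The points of the closed disc that violate the bound form a compact set disjoint from the circle.
\<close>

lemma strict_bound_near_circle:
  fixes F :: "complex \<Rightarrow> real"
  assumes F: "continuous_on (cball 0 1) F" and bound: "\<And>z. norm z = 1 \<Longrightarrow> F z < c"
  obtains r where "r < 1" "\<And>z. r \<le> norm z \<Longrightarrow> norm z \<le> 1 \<Longrightarrow> F z < c"
proof -
  define C where "C = cball 0 1 \<inter> F -` {c..}"
  have "closed C"
    unfolding C_def by (intro continuous_closed_preimage F) auto
  moreover have "bounded C"
    unfolding C_def by (rule bounded_subset[of "cball 0 1"]) auto
  ultimately have C: "compact C"
    by (simp add: compact_eq_bounded_closed)
  show ?thesis
  proof (cases "C = {}")
    case True
    then show ?thesis
      by (intro that[of 0]) (auto simp: C_def not_le[symmetric])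
  next
    case False
    obtain m where m: "m \<in> C" "\<And>z. z \<in> C \<Longrightarrow> norm z \<le> norm m"
      using continuous_attains_sup[OF C False continuous_on_norm_id] by blast
    have "norm m < 1"
      using m(1) bound[of m] by (force simp: C_def)
    moreover have "F z < c" if "(norm m + 1) / 2 \<le> norm z" "norm z \<le> 1" for z
      using m(2)[of z] that \<open>norm m < 1\<close> by (force simp: C_def)
    ultimately show ?thesis
      by (intro that[of "(norm m + 1) / 2"]) auto
  qed
qed

text \<open>
  On the circle \<open>Re z = (z + 1/z) / 2\<close> and \<open>Im z = (z - 1/z) / (2 * \<i>)\<close>, so a polynomial in \<open>Re z\<close> and
  \<open>Im z\<close> is a Laurent polynomial in \<open>z\<close>; a power of \<open>z\<close> clears its denominators.
\<close>

lemma real_polynomial_function_on_circle: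
  fixes p :: "complex \<Rightarrow> real"
  assumes "real_polynomial_function p"
  shows "\<exists>N Q. Q holomorphic_on UNIV \<and> (\<forall>z. norm z = 1 \<longrightarrow> Q z = z ^ N * of_real (p z))"
  using assms
proof induction
  case (linear f)
  interpret bounded_linear f by fact
  have f: "f z = Re z * f 1 + Im z * f \<i>" for z
  proof -
    have "z = Re z *\<^sub>R 1 + Im z *\<^sub>R \<i>"
      by (simp add: complex_eq_iff)
    then show ?thesis
      by (metis add scaleR real_scaleR_def)
  qed
  define Q where "Q z = (z\<^sup>2 + 1) / 2 * of_real (f 1) + (z\<^sup>2 - 1) / (2 * \<i>) * of_real (f \<i>)" for z
  have "Q z = z ^ 1 * of_real (f z)" if "norm z = 1" for z
  proof -
    have 1: "z * cnj z = 1"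
      using that by (simp add: complex_norm_square[symmetric])
    have "z\<^sup>2 + 1 = z * of_real (2 * Re z)"
      unfolding complex_add_cnj[symmetric] by (simp only: 1 power2_eq_square distrib_left)
    moreover have "z\<^sup>2 - 1 = z * (of_real (2 * Im z) * \<i>)"
      unfolding complex_diff_cnj[symmetric] by (simp only: 1 power2_eq_square right_diff_distrib)
    ultimately show ?thesis
      unfolding Q_def f[of z] by (simp add: field_simps)
  qed
  moreover have "Q holomorphic_on UNIV"
    unfolding Q_def by (intro holomorphic_intros) auto
  ultimately show ?case by blast
next
  case (const c)
  have "(\<lambda>z. of_real c :: complex) holomorphic_on UNIV" by simp
  then show ?case by (intro exI[of _ 0] exI[of _ "\<lambda>z. of_real c"]) auto
next
  case (add p q)
  then obtain M P N Q where
    "P holomorphic_on UNIV" "\<And>z. norm z = 1 \<Longrightarrow> P z = z ^ M * of_real (p z)"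
    "Q holomorphic_on UNIV" "\<And>z. norm z = 1 \<Longrightarrow> Q z = z ^ N * of_real (q z)"
    by metis
  then show ?case
    by (intro exI[of _ "M + N"] exI[of _ "\<lambda>z. P z * z ^ N + Q z * z ^ M"])
       (auto intro!: holomorphic_intros simp: power_add algebra_simps)
next
  case (mult p q)
  then obtain M P N Q where
    "P holomorphic_on UNIV" "\<And>z. norm z = 1 \<Longrightarrow> P z = z ^ M * of_real (p z)"
    "Q holomorphic_on UNIV" "\<And>z. norm z = 1 \<Longrightarrow> Q z = z ^ N * of_real (q z)"
    by metis
  then show ?case
    by (intro exI[of _ "M + N"] exI[of _ "\<lambda>z. P z * Q z"])
       (auto intro!: holomorphic_intros simp: power_add algebra_simps)
qed

lemma entire_approximation_near_circle:
  fixes s :: "complex \<Rightarrow> real"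
  assumes s: "continuous_on (cball 0 1) s" and d: "0 < d"
  obtains N Q r where "Q holomorphic_on UNIV" "r < 1"
    "\<And>z. r \<le> norm z \<Longrightarrow> norm z \<le> 1 \<Longrightarrow> norm (Q z - z ^ N * of_real (s z)) < d"
proof -
  have "continuous_on (sphere 0 1) s"
    by (rule continuous_on_subset[OF s]) auto
  then obtain p where p: "real_polynomial_function p" "\<And>z. norm z = 1 \<Longrightarrow> \<bar>s z - p z\<bar> < d"
    using Stone_Weierstrass_real_polynomial_function[OF compact_sphere _ d, of 0 1 s]
    by (metis dist_0_norm mem_sphere)
  obtain N Q where Q: "Q holomorphic_on UNIV"
      "\<And>z. norm z = 1 \<Longrightarrow> Q z = z ^ N * of_real (p z)"
    using real_polynomial_function_on_circle[OF p(1)] by blast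
  have "continuous_on (cball 0 1) (\<lambda>z. norm (Q z - z ^ N * of_real (s z)))"
    using s holomorphic_on_imp_continuous_on[OF Q(1)]
    by (intro continuous_intros) (auto intro: continuous_on_subset)
  moreover have "norm (Q z - z ^ N * of_real (s z)) < d" if "norm z = 1" for z
  proof -
    have "Q z - z ^ N * of_real (s z) = z ^ N * of_real (p z - s z)"
      by (simp add: Q(2)[OF that] algebra_simps)
    then show ?thesis
      using p(2)[OF that] that
      by (simp add: norm_mult norm_power abs_minus_commute del: of_real_diff)
  qed
  ultimately show ?thesis
    using strict_bound_near_circle[of _ d] Q(1) that by (metis (no_types, lifting))
qed

text \<open>
  With \<open>Q z \<approx> z ^ N * s z\<close> near the circle, replace \<open>s z * z ^ n\<close> in the numerator of
  \<open>s z * kern (\<sigma> * z ^ n)\<close> by \<open>Q z * z ^ (n - N)\<close>. The result is holomorphic, and the remaining power of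
  \<open>z\<close> makes it small on smaller discs. The radius \<open>r\<close> is chosen before \<open>n\<close>, and all large \<open>n\<close> work, so
  that two such waves can be given a common exponent.
\<close>

lemma kern_wave:
  fixes s :: "complex \<Rightarrow> real"
  assumes s: "continuous_on (cball 0 1) s" and \<sigma>: "norm \<sigma> = 1"
  obtains r where "r < 1"
    "\<And>\<rho> e. \<rho> < 1 \<Longrightarrow> 0 < e \<Longrightarrow> \<forall>\<^sub>F n in sequentially. \<exists>\<phi>\<in>disc_algebra.
       (\<forall>z. norm z \<le> \<rho> \<longrightarrow> norm (\<phi> z) \<le> e) \<and>
       (\<forall>z. r \<le> norm z \<longrightarrow> norm z \<le> 1 \<longrightarrow>
          norm (\<phi> z - of_real (s z) * kern (\<sigma> * z ^ n)) \<le> 1/2)"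
proof -
  \<comment> \<open>The numerator 2 and the denominator, at least \<open>1/20\<close>, turn an error of \<open>1/80\<close> into at most \<open>1/2\<close>.\<close>
  obtain N Q r where Q: "Q holomorphic_on UNIV" and "r < 1"
    and approx: "\<And>z. r \<le> norm z \<Longrightarrow> norm z \<le> 1 \<Longrightarrow> norm (Q z - z ^ N * of_real (s z)) < 1/80"
    by (rule entire_approximation_near_circle[OF s, of "1/80"]) auto
  have "compact (Q ` cball 0 1)"
    using holomorphic_on_imp_continuous_on[OF Q]
    by (intro compact_continuous_image) (auto intro: continuous_on_subset)
  then obtain M where M: "0 < M" "\<And>z. norm z \<le> 1 \<Longrightarrow> norm (Q z) \<le> M"
    by (force dest!: compact_imp_bounded simp: bounded_pos)
  have "\<forall>\<^sub>F n in sequentially. \<exists>\<phi>\<in>disc_algebra.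
       (\<forall>z. norm z \<le> \<rho> \<longrightarrow> norm (\<phi> z) \<le> e) \<and>
       (\<forall>z. r \<le> norm z \<longrightarrow> norm z \<le> 1 \<longrightarrow>
          norm (\<phi> z - of_real (s z) * kern (\<sigma> * z ^ n)) \<le> 1/2)"
    if "\<rho> < 1" "0 < e" for \<rho> e
  proof -
    \<comment> \<open>\<open>\<rho>\<close> may be negative, while convergence of the powers to 0 needs a base in \<open>[0, 1)\<close>.\<close>
    define t where "t = max 0 \<rho>"
    have t: "0 \<le> t" "t < 1" "\<rho> \<le> t"
      using that by (auto simp: t_def)
    have "(\<lambda>n. 40 * M * t ^ n) \<longlonglongrightarrow> 40 * M * 0"
      using t by (intro tendsto_intros LIMSEQ_realpow_zero) auto
    then have "\<forall>\<^sub>F n in sequentially. 40 * M * t ^ n < e"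
      using \<open>0 < e\<close> by (intro order_tendstoD) auto
    then have "\<forall>\<^sub>F n in sequentially. 40 * M * t ^ (n - N) < e"
      by (rule eventually_compose_filterlim) (rule filterlim_minus_const_nat_at_top)
    then show ?thesis
      using eventually_ge_at_top[of N]
    proof eventually_elim
      case (elim n)
      define \<phi> where "\<phi> z = - 2 * \<sigma> * (Q z * z ^ (n - N)) / (21/20 - \<sigma> * z ^ n)" for z
      have den: "1/20 \<le> norm (21/20 - \<sigma> * z ^ n)" if "norm z \<le> 1" for z
        using that \<sigma> by (intro kern_denominator) (simp add: norm_mult norm_power power_le_one)
      have nz: "21/20 - \<sigma> * z ^ n \<noteq> 0" if "norm z \<le> 1" for z
      proof
        assume eq: "21/20 - \<sigma> * z ^ n = 0"
        show False
          using den[OF that] unfolding eq by simp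
      qed
      have quot: "norm (- 2 * \<sigma> * x / (21/20 - \<sigma> * z ^ n)) \<le> 40 * norm x"
        if "norm z \<le> 1" for x z
      proof -
        have "norm (- 2 * \<sigma> * x / (21/20 - \<sigma> * z ^ n))
              = 2 * norm x / norm (21/20 - \<sigma> * z ^ n)"
          using \<sigma> by (simp add: norm_mult norm_divide)
        also have "\<dots> \<le> 2 * norm x / (1/20)"
          using den[OF that] by (intro frac_le) auto
        finally show ?thesis by simp
      qed
      have "\<phi> \<in> disc_algebra"
        unfolding disc_algebra_def \<phi>_def using nz Q
        by (auto intro!: continuous_intros holomorphic_intros
            intro: holomorphic_on_subset continuous_on_subset[OF holomorphic_on_imp_continuous_on[OF Q]])
      moreover have "norm (\<phi> z) \<le> e" if "norm z \<le> \<rho>" for z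
      proof -
        have z: "norm z \<le> t" "norm z \<le> 1"
          using that t by auto
        have "norm (\<phi> z) \<le> 40 * norm (Q z * z ^ (n - N))"
          unfolding \<phi>_def by (rule quot) (use z in auto)
        also have "\<dots> \<le> 40 * (M * t ^ (n - N))"
          unfolding norm_mult norm_power using z M t
          by (intro mult_left_mono mult_mono power_mono) auto
        finally show ?thesis using elim(1) by simp
      qed
      moreover have "norm (\<phi> z - of_real (s z) * kern (\<sigma> * z ^ n)) \<le> 1/2"
        if z: "r \<le> norm z" "norm z \<le> 1" for z
      proof -
        have "z ^ n = z ^ N * z ^ (n - N)"
          using elim(2) by (simp flip: power_add)
        then have "\<phi> z - of_real (s z) * kern (\<sigma> * z ^ n)
            = - 2 * \<sigma> * ((Q z - z ^ N * of_real (s z)) * z ^ (n - N)) / (21/20 - \<sigma> * z ^ n)"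
          using nz[OF z(2)] unfolding \<phi>_def kern_def by (simp add: divide_simps) (simp add: algebra_simps)
        then have "norm (\<phi> z - of_real (s z) * kern (\<sigma> * z ^ n))
            \<le> 40 * norm ((Q z - z ^ N * of_real (s z)) * z ^ (n - N))"
          using quot[OF z(2)] by metis
        also have "\<dots> \<le> 40 * (1/80 * 1)"
          unfolding norm_mult norm_power using approx[OF z] z
          by (intro mult_left_mono mult_mono power_le_one) auto
        finally show ?thesis by simp
      qed
      ultimately show ?case by blast
    qed
  qed
  then show ?thesis
    using that \<open>r < 1\<close> by blast
qed

text \<open>
  The estimate \<open>kern_push\<close> is applied at each \<open>z\<close> near the circle to \<open>a = Re (g z)\<close>, \<open>b = Re (h z)\<close> and
  \<open>w = z ^ n\<close>; the waves with \<open>\<sigma> = 1\<close> and \<open>\<sigma> = - 1\<close> realise its two summands up to \<open>1/2\<close>.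
\<close>

lemma raise_on_circle:
  assumes g: "g \<in> disc_algebra" and h: "h \<in> disc_algebra"
    and K: "\<And>z. norm z = 1 \<Longrightarrow> K \<le> max (Re (g z)) (Re (h z))"
    and "\<rho> < 1" and e: "0 < e"
  obtains g' h' r where "g' \<in> disc_algebra" "h' \<in> disc_algebra" "\<rho> \<le> r" "r < 1"
    "\<And>z. norm z = 1 \<Longrightarrow> K + 1 \<le> max (Re (g' z)) (Re (h' z))"
    "\<And>z. norm z \<le> r \<Longrightarrow> norm (g' z - g z) \<le> e \<and> norm (h' z - h z) \<le> e"
    "\<And>z. r \<le> norm z \<Longrightarrow> norm z \<le> 1 \<Longrightarrow> K - 41 \<le> max (Re (g' z)) (Re (h' z))"
proof -
  \<comment> \<open>The bound by \<open>K\<close> on the circle persists nearby only with a loss. Losing \<open>1/2\<close> here and \<open>1/2\<close> in the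
    waves leaves 1 of the gain 2, and turns the drop of 40 into 41.\<close>
  define L where "L = K - 1/2"
  have cont: "continuous_on (cball 0 1) g" "continuous_on (cball 0 1) h"
    using g h by (auto simp: disc_algebra_def)
  define s where "s z = weight L (Re (g z))" for z
  define t where "t z = weight L (Re (h z))" for z
  have st: "continuous_on (cball 0 1) s" "continuous_on (cball 0 1) t"
    unfolding s_def t_def weight_def using cont by (auto intro!: continuous_intros)
  obtain r1 where "r1 < 1" and wave_g: "\<And>\<rho> e. \<rho> < 1 \<Longrightarrow> 0 < e \<Longrightarrow>
       \<forall>\<^sub>F n in sequentially. \<exists>\<phi>\<in>disc_algebra.
         (\<forall>z. norm z \<le> \<rho> \<longrightarrow> norm (\<phi> z) \<le> e) \<and>
         (\<forall>z. r1 \<le> norm z \<longrightarrow> norm z \<le> 1 \<longrightarrow>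
            norm (\<phi> z - of_real (s z) * kern (1 * z ^ n)) \<le> 1/2)"
    by (rule kern_wave[OF st(1), of 1]) (simp, rule that)
  obtain r2 where "r2 < 1" and wave_h: "\<And>\<rho> e. \<rho> < 1 \<Longrightarrow> 0 < e \<Longrightarrow>
       \<forall>\<^sub>F n in sequentially. \<exists>\<phi>\<in>disc_algebra.
         (\<forall>z. norm z \<le> \<rho> \<longrightarrow> norm (\<phi> z) \<le> e) \<and>
         (\<forall>z. r2 \<le> norm z \<longrightarrow> norm z \<le> 1 \<longrightarrow>
            norm (\<phi> z - of_real (t z) * kern (- 1 * z ^ n)) \<le> 1/2)"
    by (rule kern_wave[OF st(2), of "- 1"]) (simp, rule that)
  have "continuous_on (cball 0 1) (\<lambda>z. - max (Re (g z)) (Re (h z)))"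
    using cont by (intro continuous_intros)
  moreover have "- max (Re (g z)) (Re (h z)) < - L" if "norm z = 1" for z
    using K[OF that] by (simp add: L_def)
  ultimately obtain r3 where r3: "r3 < 1"
      "\<And>z. r3 \<le> norm z \<Longrightarrow> norm z \<le> 1 \<Longrightarrow> - max (Re (g z)) (Re (h z)) < - L"
    using strict_bound_near_circle[of "\<lambda>z. - max (Re (g z)) (Re (h z))" "- L"] by blast
  define r where "r = Max {\<rho>, r1, r2, r3}"
  have r: "\<rho> \<le> r" "r1 \<le> r" "r2 \<le> r" "r3 \<le> r" "r < 1"
    using \<open>\<rho> < 1\<close> \<open>r1 < 1\<close> \<open>r2 < 1\<close> r3(1) by (auto simp: r_def)
  obtain n where "\<exists>\<phi>\<in>disc_algebra. (\<forall>z. norm z \<le> r \<longrightarrow> norm (\<phi> z) \<le> e) \<and>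
       (\<forall>z. r1 \<le> norm z \<longrightarrow> norm z \<le> 1 \<longrightarrow>
          norm (\<phi> z - of_real (s z) * kern (1 * z ^ n)) \<le> 1/2)"
    and "\<exists>\<psi>\<in>disc_algebra. (\<forall>z. norm z \<le> r \<longrightarrow> norm (\<psi> z) \<le> e) \<and>
       (\<forall>z. r2 \<le> norm z \<longrightarrow> norm z \<le> 1 \<longrightarrow>
          norm (\<psi> z - of_real (t z) * kern (- 1 * z ^ n)) \<le> 1/2)"
    using eventually_happens'[OF sequentially_bot
        eventually_conj[OF wave_g[OF r(5) e] wave_h[OF r(5) e]]] by (elim exE conjE) (rule that)
  then obtain \<phi> \<psi> where \<phi>: "\<phi> \<in> disc_algebra" "\<And>z. norm z \<le> r \<Longrightarrow> norm (\<phi> z) \<le> e"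
      "\<And>z. r1 \<le> norm z \<Longrightarrow> norm z \<le> 1 \<Longrightarrow> norm (\<phi> z - of_real (s z) * kern (1 * z ^ n)) \<le> 1/2"
    and \<psi>: "\<psi> \<in> disc_algebra" "\<And>z. norm z \<le> r \<Longrightarrow> norm (\<psi> z) \<le> e"
      "\<And>z. r2 \<le> norm z \<Longrightarrow> norm z \<le> 1 \<Longrightarrow> norm (\<psi> z - of_real (t z) * kern (- 1 * z ^ n)) \<le> 1/2"
    by blast
  define A where "A z = Re (g z) + s z * Re (kern (z ^ n))" for z
  define B where "B z = Re (h z) + t z * Re (kern (- (z ^ n)))" for z
  have close: "max (A z) (B z) - 1/2 \<le> max (Re (g z + \<phi> z)) (Re (h z + \<psi> z))"
    if z: "r \<le> norm z" "norm z \<le> 1" for z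
  proof -
    have "\<bar>Re (\<phi> z) - s z * Re (kern (z ^ n))\<bar> \<le> 1/2"
      using abs_Re_le_cmod[of "\<phi> z - of_real (s z) * kern (z ^ n)"] \<phi>(3)[of z] z r by simp
    moreover have "\<bar>Re (\<psi> z) - t z * Re (kern (- (z ^ n)))\<bar> \<le> 1/2"
      using abs_Re_le_cmod[of "\<psi> z - of_real (t z) * kern (- (z ^ n))"] \<psi>(3)[of z] z r by simp
    ultimately show ?thesis
      unfolding A_def B_def plus_complex.sel by linarith
  qed
  have push: "L - 40 \<le> max (A z) (B z)" "norm z = 1 \<Longrightarrow> L + 2 \<le> max (A z) (B z)"
    if z: "r \<le> norm z" "norm z \<le> 1" for z
  proof -
    have w: "norm (z ^ n) \<le> 1" "norm z = 1 \<Longrightarrow> norm (z ^ n) = 1"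
      using z by (auto simp: norm_power power_le_one)
    have L: "L \<le> max (Re (g z)) (Re (h z))"
      using r3(2)[of z] z r by simp
    show "L - 40 \<le> max (A z) (B z)"
      unfolding A_def B_def s_def t_def by (rule kern_push(1)[OF w(1) L])
    show "L + 2 \<le> max (A z) (B z)" if "norm z = 1"
      unfolding A_def B_def s_def t_def by (rule kern_push(2)[OF w(1) L w(2)[OF that]])
  qed
  show ?thesis
  proof (rule that[of "\<lambda>z. g z + \<phi> z" "\<lambda>z. h z + \<psi> z" r])
    show "(\<lambda>z. g z + \<phi> z) \<in> disc_algebra" "(\<lambda>z. h z + \<psi> z) \<in> disc_algebra"
      using g h \<phi>(1) \<psi>(1) by (auto simp: disc_algebra_def intro!: continuous_intros holomorphic_intros)
    show "K + 1 \<le> max (Re (g z + \<phi> z)) (Re (h z + \<psi> z))" if "norm z = 1" for z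
      using close[of z] push(2)[of z] that r(5) by (simp add: L_def)
    show "K - 41 \<le> max (Re (g z + \<phi> z)) (Re (h z + \<psi> z))" if "r \<le> norm z" "norm z \<le> 1" for z
      using close[OF that] push(1)[OF that] by (simp add: L_def)
  qed (use r \<phi>(2) \<psi>(2) in auto)
qed

section \<open>Passage to the limit\<close>

lemma geometric_steps_limit:
  fixes x :: "nat \<Rightarrow> 'a::banach"
  assumes "\<And>j. m \<le> j \<Longrightarrow> norm (x (Suc j) - x j) \<le> (1/2) ^ j"
  shows "convergent x" and "norm (lim x - x m) \<le> 2 * (1/2) ^ m"
proof -
  define d where "d j = x (Suc (j + m)) - x (j + m)" for j
  have d: "norm (d j) \<le> (1/2) ^ m * (1/2) ^ j" for j
    using assms[of "j + m"] by (simp add: d_def power_add mult.commute)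
  have geo: "(\<lambda>j. (1/2::real) ^ m * (1/2) ^ j) sums ((1/2) ^ m * 2)"
    using sums_mult[OF geometric_sums[of "1/2::real"]] by simp
  have "(\<Sum>j<n. d j) = x (n + m) - x m" for n
    by (induction n) (simp_all add: d_def)
  moreover have "summable d"
    using d geo by (intro summable_comparison_test'[OF sums_summable[OF geo]]) auto
  ultimately have "(\<lambda>n. x (n + m) - x m) \<longlonglongrightarrow> suminf d"
    using summable_LIMSEQ by (metis (no_types, lifting) ext)
  then have "(\<lambda>n. x (n + m) - x m + x m) \<longlonglongrightarrow> suminf d + x m"
    by (intro tendsto_intros)
  then have lim: "x \<longlonglongrightarrow> suminf d + x m"
    using LIMSEQ_offset[of x m] by simp
  show "convergent x"
    using lim by (rule convergentI)
  have "norm (suminf d) \<le> (1/2) ^ m * 2"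
    using d by (rule norm_suminf_le[OF _ sums_summable[OF geo], folded sums_unique[OF geo]])
  then show "norm (lim x - x m) \<le> 2 * (1/2) ^ m"
    using limI[OF lim] by simp
qed

text \<open>
  Since \<open>r\<close> tends to 1, a closed disc inside the unit disc lies in all but finitely many of the discs
  of radius \<open>r k\<close>, so the sequence converges uniformly there.
\<close>

lemma limit_of_disc_algebra:
  fixes G :: "nat \<Rightarrow> complex \<Rightarrow> complex"
  assumes G: "\<And>k. G k \<in> disc_algebra" and r: "r \<longlonglongrightarrow> 1"
    and step: "\<And>k z. norm z \<le> r k \<Longrightarrow> norm (G (Suc k) z - G k z) \<le> (1/2) ^ k"
  shows "(\<lambda>z. lim (\<lambda>k. G k z)) holomorphic_on ball 0 1"
proof (rule holomorphic_uniform_sequence[of _ G])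
  show "G n holomorphic_on ball 0 1" for n
    using G by (simp add: disc_algebra_def)
  fix x :: complex assume "x \<in> ball 0 1"
  then obtain d where d: "0 < d" "cball x d \<subseteq> ball 0 1"
    using open_contains_cball[of "ball 0 (1::real)"] by (metis open_ball)
  \<comment> \<open>A point of largest modulus; its norm serves as the radius of a disc about 0 containing \<open>cball x d\<close>.\<close>
  obtain q where q: "q \<in> cball x d" "\<And>z. z \<in> cball x d \<Longrightarrow> norm z \<le> norm q"
    using continuous_attains_sup[OF compact_cball _ continuous_on_norm_id, of x d] d(1) by auto
  have "norm q < 1"
    using q(1) d(2) by auto
  then obtain m where m: "\<And>k. m \<le> k \<Longrightarrow> norm q < r k"
    using order_tendstoD(1)[OF r] by (auto simp: eventually_sequentially)
  have near: "norm (lim (\<lambda>k. G k z) - G k z) \<le> 2 * (1/2) ^ k" if "m \<le> k" "z \<in> cball x d" for k z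
  proof (rule geometric_steps_limit(2))
    fix j assume "k \<le> j"
    then have "norm z \<le> r j"
      using that q(2)[of z] m[of j] by linarith
    then show "norm (G (Suc j) z - G j z) \<le> (1/2) ^ j"
      by (rule step)
  qed
  have "uniform_limit (cball x d) G (\<lambda>z. lim (\<lambda>k. G k z)) sequentially"
  proof (rule uniform_limitI)
    fix e :: real assume "0 < e"
    have "(\<lambda>k. 2 * (1/2) ^ k :: real) \<longlonglongrightarrow> 2 * 0"
      by (intro tendsto_intros LIMSEQ_realpow_zero) auto
    then have "\<forall>\<^sub>F k in sequentially. 2 * (1/2) ^ k < e"
      using \<open>0 < e\<close> by (intro order_tendstoD) auto
    then show "\<forall>\<^sub>F k in sequentially. \<forall>z\<in>cball x d. dist (G k z) (lim (\<lambda>k. G k z)) < e"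
      using eventually_ge_at_top[of m]
    proof eventually_elim
      case (elim k)
      show ?case
      proof
        fix z assume "z \<in> cball x d"
        then show "dist (G k z) (lim (\<lambda>k. G k z)) < e"
          using near[OF elim(2)] elim(1) by (subst dist_commute) (auto simp: dist_norm intro: le_less_trans)
      qed
    qed
  qed
  then show "\<exists>d>0. cball x d \<subseteq> ball 0 1 \<and> uniform_limit (cball x d) G (\<lambda>z. lim (\<lambda>k. G k z)) sequentially"
    using d by blast
qed simp

text \<open>
  The steps are iterated from the pair \<open>(0, 0)\<close>, keeping the maximum at least \<open>k\<close> on the circle after
  \<open>k\<close> steps. The radii are forced to 1 by requiring \<open>r k \<ge> 1 - 1 / (k + 1)\<close>.
\<close>

lemma raising_sequence:
  obtains G H :: "nat \<Rightarrow> complex \<Rightarrow> complex" and r :: "nat \<Rightarrow> real"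
  where "\<And>k. G k \<in> disc_algebra" "\<And>k. H k \<in> disc_algebra"
    "r \<longlonglongrightarrow> 1" "\<And>k. r k < 1"
    "\<And>k z. norm z \<le> r k \<Longrightarrow> norm (G (Suc k) z - G k z) \<le> (1/2) ^ k"
    "\<And>k z. norm z \<le> r k \<Longrightarrow> norm (H (Suc k) z - H k z) \<le> (1/2) ^ k"
    "\<And>k z. r k \<le> norm z \<Longrightarrow> norm z \<le> 1 \<Longrightarrow>
       real k - 41 \<le> max (Re (G (Suc k) z)) (Re (H (Suc k) z))"
proof -
  define P where "P k p \<longleftrightarrow> fst p \<in> disc_algebra \<and> snd p \<in> disc_algebra \<and>
      (\<forall>z. norm z = 1 \<longrightarrow> real k \<le> max (Re (fst p z)) (Re (snd p z)))" for k p
  define S where "S k p p' \<rho> \<longleftrightarrow> 1 - 1 / real (Suc k) \<le> \<rho> \<and> \<rho> < 1 \<and>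
      (\<forall>z::complex. norm z \<le> \<rho> \<longrightarrow>
         norm (fst p' z - fst p z :: complex) \<le> (1/2) ^ k \<and>
         norm (snd p' z - snd p z :: complex) \<le> (1/2) ^ k) \<and>
      (\<forall>z. \<rho> \<le> norm z \<longrightarrow> norm z \<le> 1 \<longrightarrow>
         real k - 41 \<le> max (Re (fst p' z)) (Re (snd p' z)))"
    for k p p' \<rho>
  have "\<exists>f. \<forall>k. P k (f k) \<and> (\<exists>\<rho>. S k (f k) (f (Suc k)) \<rho>)"
  proof (rule dependent_nat_choice)
    show "\<exists>p. P 0 p"
      by (intro exI[of _ "(\<lambda>z. 0, \<lambda>z. 0)"]) (simp add: P_def disc_algebra_def)
    fix p k assume "P k p"
    then have p: "fst p \<in> disc_algebra" "snd p \<in> disc_algebra"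
        "\<And>z. norm z = 1 \<Longrightarrow> real k \<le> max (Re (fst p z)) (Re (snd p z))"
      by (auto simp: P_def)
    obtain g' h' \<rho> where "g' \<in> disc_algebra" "h' \<in> disc_algebra" "1 - 1 / real (Suc k) \<le> \<rho>" "\<rho> < 1"
      "\<And>z. norm z = 1 \<Longrightarrow> real k + 1 \<le> max (Re (g' z)) (Re (h' z))"
      "\<And>z. norm z \<le> \<rho> \<Longrightarrow> norm (g' z - fst p z) \<le> (1/2) ^ k \<and> norm (h' z - snd p z) \<le> (1/2) ^ k"
      "\<And>z. \<rho> \<le> norm z \<Longrightarrow> norm z \<le> 1 \<Longrightarrow> real k - 41 \<le> max (Re (g' z)) (Re (h' z))"
      by (rule raise_on_circle[OF p, of "1 - 1 / real (Suc k)" "(1/2) ^ k"]) auto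
    then have "P (Suc k) (g', h') \<and> S k p (g', h') \<rho>"
      by (simp add: P_def S_def add.commute)
    then show "\<exists>p'. P (Suc k) p' \<and> (\<exists>\<rho>. S k p p' \<rho>)"
      by blast
  qed
  then obtain f r where f: "\<And>k. P k (f k)" and r: "\<And>k. S k (f k) (f (Suc k)) (r k)"
    by metis
  show ?thesis
  proof (rule that[of "\<lambda>k. fst (f k)" "\<lambda>k. snd (f k)" r])
    have "(\<lambda>k. 1 - 1 / real (Suc k)) \<longlonglongrightarrow> 1 - 0"
      by (intro tendsto_intros LIMSEQ_Suc[OF lim_1_over_n])
    moreover have "1 - 1 / real (Suc k) \<le> r k" "r k \<le> 1" for k
      using r[of k] by (auto simp: S_def)
    ultimately show "r \<longlonglongrightarrow> 1"
      by (intro tendsto_sandwich[of "\<lambda>k. 1 - 1 / real (Suc k)" r sequentially "\<lambda>k. 1" 1]) auto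
  qed (use f r in \<open>auto simp: P_def S_def\<close>)
qed

text \<open>
  For \<open>z\<close> near the circle let \<open>k\<close> be the last index with \<open>r k \<le> |z|\<close>. Step \<open>k\<close> leaves the maximum at \<open>z\<close> at
  least \<open>k - 41\<close>, and all later steps together change it by at most 2. If \<open>|z|\<close> exceeds
  \<open>r m\<close>, then \<open>k \<ge> m\<close>, so the bound grows without limit towards the circle.
\<close>

lemma max_Re_unbounded_at_circle:
  obtains g h where "g holomorphic_on ball 0 1" "h holomorphic_on ball 0 1"
    "\<And>B. \<exists>r<1. \<forall>z\<in>ball 0 1. r < norm z \<longrightarrow> B \<le> max (Re (g z)) (Re (h z))"
proof -
  obtain G H r where GH: "\<And>k. G k \<in> disc_algebra" "\<And>k. H k \<in> disc_algebra"
    and r: "r \<longlonglongrightarrow> 1" "\<And>k. r k < 1"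
    and step: "\<And>k z. norm z \<le> r k \<Longrightarrow> norm (G (Suc k) z - G k z) \<le> (1/2) ^ k"
      "\<And>k z. norm z \<le> r k \<Longrightarrow> norm (H (Suc k) z - H k z) \<le> (1/2) ^ k"
    and big: "\<And>k z. r k \<le> norm z \<Longrightarrow> norm z \<le> 1 \<Longrightarrow>
       real k - 41 \<le> max (Re (G (Suc k) z)) (Re (H (Suc k) z))"
    by (rule raising_sequence) blast
  define g where "g z = lim (\<lambda>k. G k z)" for z
  define h where "h z = lim (\<lambda>k. H k z)" for z
  have grow: "real m - 43 \<le> max (Re (g z)) (Re (h z))" if z: "norm z < 1" "r m < norm z" for m z
  proof -
    define J where "J = {k. r k \<le> norm z}"
    have "\<forall>\<^sub>F k in sequentially. norm z < r k"
      using order_tendstoD(1)[OF r(1) z(1)] .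
    then have fin: "finite J"
      unfolding J_def eventually_sequentially
      by (metis (mono_tags, lifting) finite_nat_set_iff_bounded_le linorder_le_cases linorder_not_le mem_Collect_eq)
    have "m \<in> J"
      using z(2) by (simp add: J_def)
    define k where "k = Max J"
    have "k \<in> J" "m \<le> k"
      using fin \<open>m \<in> J\<close> by (auto simp: k_def intro: Max_in)
    have after: "norm z \<le> r j" if "Suc k \<le> j" for j
    proof -
      have "j \<notin> J"
        using Max_ge[OF fin, of j] that unfolding k_def by linarith
      then show ?thesis
        by (simp add: J_def)
    qed
    have half: "2 * (1/2) ^ Suc k \<le> (2::real)"
      using power_le_one[of "1/2::real" "Suc k"] by linarith
    have "norm (g z - G (Suc k) z) \<le> 2" "norm (h z - H (Suc k) z) \<le> 2"
      using geometric_steps_limit(2)[of "Suc k" "\<lambda>k. G k z"]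
        geometric_steps_limit(2)[of "Suc k" "\<lambda>k. H k z"] after step half
      unfolding g_def h_def by (meson order_trans)+
    then have "\<bar>Re (g z) - Re (G (Suc k) z)\<bar> \<le> 2" "\<bar>Re (h z) - Re (H (Suc k) z)\<bar> \<le> 2"
      by (metis abs_Re_le_cmod minus_complex.sel(1) order_trans)+
    moreover have "real k - 41 \<le> max (Re (G (Suc k) z)) (Re (H (Suc k) z))"
      using \<open>k \<in> J\<close> z(1) by (intro big) (auto simp: J_def)
    ultimately show ?thesis
      using \<open>m \<le> k\<close> by linarith
  qed
  show ?thesis
  proof (rule that[of g h])
    show "g holomorphic_on ball 0 1" "h holomorphic_on ball 0 1"
      unfolding g_def h_def using limit_of_disc_algebra GH r(1) step by blast+
    fix B :: real
    obtain m where m: "B + 43 \<le> real m"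
      using real_arch_simple by blast
    show "\<exists>r<1. \<forall>z\<in>ball 0 1. r < norm z \<longrightarrow> B \<le> max (Re (g z)) (Re (h z))"
    proof (intro exI[of _ "r m"] conjI ballI impI)
      fix z :: complex assume "z \<in> ball 0 1" "r m < norm z"
      then show "B \<le> max (Re (g z)) (Re (h z))"
        using grow[of z m] m by simp
    qed (rule r(2))
  qed
qed

section \<open>The proper disc\<close>

theorem theorem1p3:
  shows "\<exists>f1 f2 :: complex \<Rightarrow> complex.
           f1 holomorphic_on ball 0 1 \<and> f2 holomorphic_on ball 0 1 \<and>
           proper_map (top_of_set (ball 0 1)) euclidean (\<lambda>\<zeta>. (f1 \<zeta>, f2 \<zeta>)) \<and>
           (\<lambda>\<zeta>. (f1 \<zeta>, f2 \<zeta>)) ` ball 0 1 \<subseteq> (- {0}) \<times> (- {0})"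
proof -
  obtain g h where hol: "g holomorphic_on ball 0 1" "h holomorphic_on ball 0 1"
    and grow: "\<And>B. \<exists>r<1. \<forall>z\<in>ball 0 1. r < norm z \<longrightarrow> B \<le> max (Re (g z)) (Re (h z))"
    using max_Re_unbounded_at_circle by blast
  define f where "f z = (exp (g z), exp (h z))" for z
  have cont: "continuous_on (ball 0 1) f"
    unfolding f_def using hol by (intro continuous_intros holomorphic_on_imp_continuous_on)
  have large: "max (Re (g z)) (Re (h z)) \<le> norm (f z)" for z
  proof -
    have "x \<le> exp x" for x :: real
      using exp_ge_add_one_self[of x] by linarith
    moreover have "norm (exp (g z)) \<le> norm (f z)" "norm (exp (h z)) \<le> norm (f z)"
      unfolding f_def using norm_fst_le norm_snd_le by blast+
    ultimately show ?thesis
      unfolding norm_exp_eq_Re by (meson max.boundedI order_trans)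
  qed
  have "filterlim (\<lambda>z. norm (f z)) at_top (filtercomap norm (at_left 1))"
    unfolding filterlim_at_top
  proof
    fix B :: real
    obtain r where r: "r < 1" "\<And>z. norm z < 1 \<Longrightarrow> r < norm z \<Longrightarrow> B \<le> max (Re (g z)) (Re (h z))"
      using grow[of B] by auto
    have "eventually (\<lambda>y. r < y \<and> y < 1) (at_left (1::real))"
      using r(1) eventually_at_left[of 0 "1::real"] by auto
    then show "\<forall>\<^sub>F z in filtercomap norm (at_left 1). B \<le> norm (f z)"
      unfolding eventually_filtercomap using r(2) large order_trans by blast
  qed
  then have "proper_map (top_of_set (ball 0 1)) euclidean f"
    using proper_map_unit_disc_iff[OF cont] by blast
  moreover have "(\<lambda>z. exp (g z)) holomorphic_on ball 0 1" "(\<lambda>z. exp (h z)) holomorphic_on ball 0 1"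
    using hol by (auto intro: holomorphic_intros)
  ultimately show ?thesis
    unfolding f_def by (intro exI[of _ "\<lambda>z. exp (g z)"] exI[of _ "\<lambda>z. exp (h z)"]) auto
qed

end
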